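(* Let $0\le p\le\tfrac12$. The $(\mathsf M,2)$ Scheme B with $S_1,\dots,S_{\mathsf M}$ i.i.d. $\mathrm{Bernoulli}(p)$ achieves rate $\tfrac12$ and upload cost, access complexity and leakages $$\mathsf U_{\mathsf B}=-\sum_{w=0}^{\mathsf M}\binom{\mathsf M}{w}g(w,p)\log_2g(w,p)+\mathsf M H_b(p),\qquad \Delta_{\mathsf B}=\sum_{w=0}^{\mathsf M}w\binom{\mathsf M}{w}\bigl(g(w,p)+h(w,p)\bigr),$$ $$\rho^{(\mathsf{MI})}_{\mathsf B}=\frac{\mathsf U_{\mathsf B}}2-\mathsf M H_b(p),\qquad \rho^{(\mathsf{WIL})}_{\mathsf B}=\log_2\mathsf M-\min_{w\in\{0,\dots,\mathsf M\}}H(M'_w),$$ $$\rho^{(\mathsf{MaxL})}_{\mathsf B}=\log_2\Bigl((1-p)^{\mathsf M-1}p+\sum_{w=1}^{\mathsf M}\binom{\mathsf M}{w}(1-p)^{\mathsf M-(w-1)}p^{w-1}\Bigr),$$ where $$g(w,p)=\frac1{\mathsf M}\Bigl[(\mathsf M-w)(1-p)^{\mathsf M-w-1}p^{w+1}+w(1-p)^{\mathsf M-w+1}p^{w-1}\Bigr],\qquad h(w,p)=(1-p)^{\mathsf M-w}p^w,$$ and $M'_w$ is a random variable on $\{1,\dots,\mathsf M\}$ with $$P_{M'_w}(m')=\begin{cases}\dfrac{(1-p)^{\mathsf M-w-1}p^{w+1}}{\mathsf M g(w,p)}&m'\in\{1,\dots,\mathsf M-w\},\\[2mm]\dfrac{(1-p)^{\mathsf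 M-w+1}p^{w-1}}{\mathsf M g(w,p)}&m'\in\{\mathsf M-w+1,\dots,\mathsf M\}.\end{cases}$$ (The minimum over $w$ is over those $w$ with $g(w,p)>0$.)
   Context: $H_b(p)=-p\log_2p-(1-p)\log_2(1-p)$; entropies in bits; $0\log_20=0$, $0^0=1$, and a term with prefactor $\mathsf M-w=0$ or $w=0$ is $0$. Setting: $2$ noncolluding servers each store the same $\mathsf M$ independent files. Scheme B with $n=2$ over the binary field has file length $\beta=1$, so each file $X^{(m)}$ is a uniform bit. The requested index $M$ is uniform on $\{1,\dots,\mathsf M\}$, independent of the files. The user draws $S=(S_1,\dots,S_{\mathsf M})\in\{0,1\}^{\mathsf M}$ independently of $M$ and the files. The queries are $Q_1=S+e_M$ (mod 2) and $Q_2=S$, where $e_m$ is the $m$-th unit vector in $\{0,1\}^{\mathsf M}$. Server $l$ answers the inner product $A_l=\langle Q_l,(X^{(1)},\dots,X^{(\mathsf M)})\rangle$ (mod 2), always of length $\ell_l=1$ bit; the number of accessed symbols $\delta_l(Q_l)$ is the Hamming weight of $Q_l$. Quantities: rate $\mathsf R=\beta/\sum_l\mathbb E[\ell_l(Q_l)]$; upload cost $\mathsf U=\sum_lH(Q_l)$; access complexity $\Delta=\sum_l\mathbb E[\delta_l(Q_l)]$. Leakages: $\rho^{(\mathsf{MI})}=\frac12\sum_lI(M;Q_l)$; $\rho^{(\mathsf{WIL})}=\max_l[H(M)-\min_qH(M\mid Q_l=q)]$ (min over $q$ with $P_{Q_l}(q)>0$); $\rho^{(\mathsf{MaxL})}=\max_l\log_2\sum_q\max_mP_{Q_l|M}(q|m)$.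 *)

theory Defs
  imports "HOL-Probability.Probability" "HOL-Library.Z2"
begin

section \<open>Discrete information measures in bits\<close>

definition entropy_bits :: "'a measure \<Rightarrow> ('a \<Rightarrow> 'b) \<Rightarrow> real" where
  "entropy_bits \<Omega> Y = prob_space.entropy \<Omega> 2 (count_space (Y ` space \<Omega>)) Y"

definition mutual_information_bits :: "'a measure \<Rightarrow> ('a \<Rightarrow> 'b) \<Rightarrow> ('a \<Rightarrow> 'c) \<Rightarrow> real" where
  "mutual_information_bits \<Omega> Y Z =
     prob_space.mutual_information \<Omega> 2
       (count_space (Y ` space \<Omega>)) (count_space (Z ` space \<Omega>)) Y Z"

text \<open>The entropy \<open>H(Y | Z = z)\<close> given a single value \<open>z\<close> of positive probability, that is, the
  entropy of \<open>Y\<close> under the measure conditioned on the event \<open>Z = z\<close>.\<close>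

definition entropy_given_value :: "'a measure \<Rightarrow> ('a \<Rightarrow> 'b) \<Rightarrow> ('a \<Rightarrow> 'c) \<Rightarrow> 'c \<Rightarrow> real" where
  "entropy_given_value \<Omega> Y Z z =
     entropy_bits (uniform_measure \<Omega> {\<omega> \<in> space \<Omega>. Z \<omega> = z}) Y"

definition binary_entropy :: "real \<Rightarrow> real" where
  "binary_entropy p = - p * log 2 p - (1 - p) * log 2 (1 - p)"

section \<open>Cost and leakage of a two-server scheme\<close>

text \<open>Servers are numbered 1 and 2; \<open>Q l\<close> is the query sent to server \<open>l\<close> and \<open>idx\<close> is the
  requested index, a random element of \<open>{1..M}\<close>. The number \<open>len l \<omega>\<close> is the length of the answer
  of server \<open>l\<close>, and \<open>acc q\<close> is the number of symbols a server accesses to answer \<open>q\<close>.\<close>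

definition rate :: "'a measure \<Rightarrow> nat \<Rightarrow> (nat \<Rightarrow> 'a \<Rightarrow> nat) \<Rightarrow> real" where
  "rate \<Omega> \<beta> len = real \<beta> / (\<Sum>l\<in>{1, 2}. \<integral>\<omega>. real (len l \<omega>) \<partial>\<Omega>)"

definition upload_cost :: "'a measure \<Rightarrow> (nat \<Rightarrow> 'a \<Rightarrow> 'q) \<Rightarrow> real" where
  "upload_cost \<Omega> Q = (\<Sum>l\<in>{1, 2}. entropy_bits \<Omega> (Q l))"

definition access_complexity :: "'a measure \<Rightarrow> (nat \<Rightarrow> 'a \<Rightarrow> 'q) \<Rightarrow> ('q \<Rightarrow> nat) \<Rightarrow> real" where
  "access_complexity \<Omega> Q acc = (\<Sum>l\<in>{1, 2}. \<integral>\<omega>. real (acc (Q l \<omega>)) \<partial>\<Omega>)"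

definition leakage_MI :: "'a measure \<Rightarrow> ('a \<Rightarrow> nat) \<Rightarrow> (nat \<Rightarrow> 'a \<Rightarrow> 'q) \<Rightarrow> real" where
  "leakage_MI \<Omega> idx Q = 1 / 2 * (\<Sum>l\<in>{1, 2}. mutual_information_bits \<Omega> idx (Q l))"

definition leakage_WIL :: "'a measure \<Rightarrow> ('a \<Rightarrow> nat) \<Rightarrow> (nat \<Rightarrow> 'a \<Rightarrow> 'q) \<Rightarrow> real" where
  "leakage_WIL \<Omega> idx Q =
     (MAX l\<in>{1, 2}. entropy_bits \<Omega> idx
        - (MIN q\<in>{q \<in> Q l ` space \<Omega>. \<P>(\<omega> in \<Omega>. Q l \<omega> = q) > 0}.
             entropy_given_value \<Omega> idx (Q l) q))"

definition leakage_MaxL ::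
  "'a measure \<Rightarrow> nat \<Rightarrow> ('a \<Rightarrow> nat) \<Rightarrow> (nat \<Rightarrow> 'a \<Rightarrow> 'q) \<Rightarrow> real" where
  "leakage_MaxL \<Omega> M idx Q =
     (MAX l\<in>{1, 2}. log 2 (\<Sum>q\<in>Q l ` space \<Omega>.
        (MAX m\<in>{1..M}. \<P>(\<omega> in \<Omega>. Q l \<omega> = q \<bar> idx \<omega> = m))))"

section \<open>Scheme B for two servers over the binary field\<close>

text \<open>Vectors of length \<open>M\<close> over the binary field are elements of
  \<open>{1..M} \<rightarrow>\<^sub>E (UNIV :: bit set)\<close>.\<close>

definition unit_vec :: "nat \<Rightarrow> nat \<Rightarrow> bit" where
  "unit_vec m i = (if i = m then 1 else 0)"

definition rand_vec :: "nat \<Rightarrow> (nat \<Rightarrow> 'a \<Rightarrow> bit) \<Rightarrow> 'a \<Rightarrow> nat \<Rightarrow> bit" where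
  "rand_vec M Y \<omega> = (\<lambda>i\<in>{1..M}. Y i \<omega>)"

definition query ::
  "nat \<Rightarrow> ('a \<Rightarrow> nat) \<Rightarrow> (nat \<Rightarrow> 'a \<Rightarrow> bit) \<Rightarrow> nat \<Rightarrow> 'a \<Rightarrow> nat \<Rightarrow> bit" where
  "query M idx S l \<omega> =
     (if l = 1 then (\<lambda>i\<in>{1..M}. S i \<omega> + unit_vec (idx \<omega>) i) else rand_vec M S \<omega>)"

definition hamming_weight :: "nat \<Rightarrow> (nat \<Rightarrow> bit) \<Rightarrow> nat" where
  "hamming_weight M q = card {i \<in> {1..M}. q i \<noteq> 0}"

definition file_length :: nat where
  "file_length = 1"

text \<open>The answer as a string of symbols: a single inner product in the binary field.\<close>

definition answer :: "nat \<Rightarrow> (nat \<Rightarrow> bit) \<Rightarrow> (nat \<Rightarrow> bit) \<Rightarrow> bit list" where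
  "answer M q x = [\<Sum>i\<in>{1..M}. q i * x i]"

definition answer_length ::
  "nat \<Rightarrow> ('a \<Rightarrow> nat) \<Rightarrow> (nat \<Rightarrow> 'a \<Rightarrow> bit) \<Rightarrow> (nat \<Rightarrow> 'a \<Rightarrow> bit) \<Rightarrow> nat \<Rightarrow> 'a \<Rightarrow> nat" where
  "answer_length M idx S X l \<omega> = length (answer M (query M idx S l \<omega>) (rand_vec M X \<omega>))"

text \<open>The events determined by a discrete random variable. The library's \<open>indep_vars\<close> requires all
  variables to have the same type, so mutual independence of the index, the vector \<open>S\<close> and the
  files is stated below with \<open>indep_sets\<close>.\<close>

definition rv_events :: "'a measure \<Rightarrow> ('a \<Rightarrow> 'b) \<Rightarrow> 'a set set" where
  "rv_events \<Omega> Y = {Y -` A \<inter> space \<Omega> | A. True}"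

datatype source = Index | Randomness | File nat

text \<open>\<open>X m\<close> is the file with number \<open>m\<close>. The distribution of the vector \<open>S\<close> is left open here.\<close>

definition scheme_B ::
  "'a measure \<Rightarrow> nat \<Rightarrow> ('a \<Rightarrow> nat) \<Rightarrow> (nat \<Rightarrow> 'a \<Rightarrow> bit) \<Rightarrow> (nat \<Rightarrow> 'a \<Rightarrow> bit) \<Rightarrow> bool" where
  "scheme_B \<Omega> M idx S X \<longleftrightarrow>
     prob_space \<Omega> \<and>
     idx \<in> measurable \<Omega> (count_space {1..M}) \<and>
     distr \<Omega> (count_space {1..M}) idx = uniform_count_measure {1..M} \<and>
     (\<forall>m\<in>{1..M}. X m \<in> measurable \<Omega> (count_space UNIV) \<and> \<P>(\<omega> in \<Omega>. X m \<omega> = 1) = 1 / 2) \<and>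
     (\<forall>i\<in>{1..M}. S i \<in> measurable \<Omega> (count_space UNIV)) \<and>
     prob_space.indep_sets \<Omega>
       (\<lambda>k. case k of Index \<Rightarrow> rv_events \<Omega> idx
              | Randomness \<Rightarrow> rv_events \<Omega> (rand_vec M S)
              | File m \<Rightarrow> rv_events \<Omega> (X m))
       ({Index, Randomness} \<union> File ` {1..M})"

definition iid_bernoulli :: "'a measure \<Rightarrow> nat \<Rightarrow> (nat \<Rightarrow> 'a \<Rightarrow> bit) \<Rightarrow> real \<Rightarrow> bool" where
  "iid_bernoulli \<Omega> M S p \<longleftrightarrow>
     prob_space.indep_vars \<Omega> (\<lambda>_. count_space UNIV) S {1..M} \<and>
     (\<forall>i\<in>{1..M}. \<P>(\<omega> in \<Omega>. S i \<omega> = 1) = p)"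

section \<open>Closed-form expressions\<close>

text \<open>For \<open>w \<le> M\<close> the truncated exponents \<open>M - w - 1\<close> (at \<open>w = M\<close>) and \<open>w - 1\<close> (at \<open>w = 0\<close>) occur
  only with prefactor 0 in \<open>g_B\<close>, and only on an empty range of arguments in \<open>pmf_B\<close>.\<close>

definition g_B :: "nat \<Rightarrow> nat \<Rightarrow> real \<Rightarrow> real" where
  "g_B M w p = 1 / real M *
     (real (M - w) * (1 - p) ^ (M - w - 1) * p ^ (w + 1)
      + real w * (1 - p) ^ (M - w + 1) * p ^ (w - 1))"

definition h_B :: "nat \<Rightarrow> nat \<Rightarrow> real \<Rightarrow> real" where
  "h_B M w p = (1 - p) ^ (M - w) * p ^ w"

definition pmf_B :: "nat \<Rightarrow> nat \<Rightarrow> real \<Rightarrow> nat \<Rightarrow> real" where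
  "pmf_B M w p m =
     (if m \<in> {1..M - w} then (1 - p) ^ (M - w - 1) * p ^ (w + 1) / (real M * g_B M w p)
      else if m \<in> {M - w + 1..M} then (1 - p) ^ (M - w + 1) * p ^ (w - 1) / (real M * g_B M w p)
      else 0)"

text \<open>The entropy of a random variable with probability mass function \<open>pmf_B M w p\<close> on \<open>{1..M}\<close>,
  realised as the identity on the corresponding discrete probability space. This is a probability
  space when \<open>g_B M w p > 0\<close>.\<close>

definition entropy_B :: "nat \<Rightarrow> nat \<Rightarrow> real \<Rightarrow> real" where
  "entropy_B M w p = entropy_bits (point_measure {1..M} (\<lambda>m. ennreal (pmf_B M w p m))) (\<lambda>m. m)"

definition upload_B :: "nat \<Rightarrow> real \<Rightarrow> real" where
  "upload_B M p =
     - (\<Sum>w=0..M. real (M choose w) * g_B M w p * log 2 (g_B M w p)) + real M * binary_entropy p"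

end

(*
  For fixed m the map q |-> q + e_m permutes the binary vectors, and it raises or lowers the weight
  of q by one according to whether q_m vanishes. Hence P(Q_1 = q) and the multiset of values
  P(M = m | Q_1 = q) depend on q only through its weight, and every quantity becomes a sum over
  weights. The same permutation gives H(Q_1 | M) = H(S) = M H_b(p), the mean of the binomial
  distribution giving the last equality. As p <= 1 - p, the largest P(Q_1 = q | M = m) lowers
  the weight whenever q is nonzero. The second query is independent of the index, so it never
  attains a larger leakage than the first.
*)
theory Submission
  imports Defs
begin

section \<open>Discrete random variables with finite range\<close>

text \<open>The set of attained queries depends on the sample space, whereas the flips permute, and
  the weight classes partition, the set of all binary vectors. Every sum over attained values is
  therefore enlarged to a fixed finite set; values that do not occur have probability 0 and add
  nothing, even where a logarithm or a quotient degenerates. The same care is needed at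
  \<open>p = 0\<close>, where many vectors are null: logarithms of products and quotients are split
  only under the mass as a prefactor, with mass 0 set aside. The maximum over the servers is settled
  by comparison with the value 0 of an independent query: for the worst-case leakage because an
  entropy on \<open>M\<close> points is at most \<open>log 2 M\<close>, for the maximal leakage
  because the maxima over the index dominate any single conditional distribution, whose total is
  1.\<close>

lemma entropy_bits_eq_sum:
  assumes "prob_space \<Omega>" and Y: "simple_function \<Omega> Y"
    and A: "finite A" "Y ` space \<Omega> \<subseteq> A"
  shows "entropy_bits \<Omega> Y
    = - (\<Sum>y\<in>A. \<P>(\<omega> in \<Omega>. Y \<omega> = y) * log 2 (\<P>(\<omega> in \<Omega>. Y \<omega> = y)))"
proof -
  interpret prob_space \<Omega> by fact
  interpret information_space \<Omega> 2 by standard simp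
  let ?P = "\<lambda>y. \<P>(\<omega> in \<Omega>. Y \<omega> = y)"
  have "simple_distributed \<Omega> Y ?P"
    using Y by (rule simple_distributedI) (auto intro!: arg_cong[where f = prob])
  then have "entropy_bits \<Omega> Y = - (\<Sum>y\<in>Y ` space \<Omega>. ?P y * log 2 (?P y))"
    unfolding entropy_bits_def by (rule entropy_simple_distributed)
  also have "(\<Sum>y\<in>Y ` space \<Omega>. ?P y * log 2 (?P y)) = (\<Sum>y\<in>A. ?P y * log 2 (?P y))"
  proof (rule sum.mono_neutral_left[OF A], safe)
    fix y assume "y \<in> A" "y \<notin> Y ` space \<Omega>"
    then have "{\<omega> \<in> space \<Omega>. Y \<omega> = y} = {}" by auto
    then show "?P y * log 2 (?P y) = 0" by (simp only: measure_empty)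
  qed
  finally show ?thesis .
qed

text \<open>Needed, through its conditional form below, to show that the worst-case leakage of the
  first server is nonnegative.\<close>

lemma entropy_bits_le_log_card:
  assumes "prob_space \<Omega>" and Y: "simple_function \<Omega> Y"
    and A: "finite A" "Y ` space \<Omega> \<subseteq> A"
  shows "entropy_bits \<Omega> Y \<le> log 2 (card A)"
proof -
  interpret prob_space \<Omega> by fact
  interpret information_space \<Omega> 2 by standard simp
  let ?P = "\<lambda>y. \<P>(\<omega> in \<Omega>. Y \<omega> = y)"
  have "simple_distributed \<Omega> Y ?P"
    using Y by (rule simple_distributedI) (auto intro!: arg_cong[where f = prob])
  then have "entropy_bits \<Omega> Y \<le> log 2 (card (Y ` space \<Omega>))"
    unfolding entropy_bits_def by (rule entropy_le_card)
  also have "\<dots> \<le> log 2 (card A)"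
    using A not_empty card_mono[OF A] finite_subset[OF A(2,1)]
    by (subst log_le_cancel_iff) (auto simp: card_gt_0_iff)
  finally show ?thesis .
qed

text \<open>Both claims are the unconditional ones for the measure conditioned on
  \<open>Z = z\<close>, under which the point masses of \<open>Y\<close> are the quotients of joint
  by marginal masses.\<close>

lemma
  assumes "prob_space \<Omega>" and Y: "simple_function \<Omega> Y" and Z: "simple_function \<Omega> Z"
    and A: "finite A" "Y ` space \<Omega> \<subseteq> A"
    and pos: "0 < \<P>(\<omega> in \<Omega>. Z \<omega> = z)"
  shows entropy_given_value_eq_sum: "entropy_given_value \<Omega> Y Z z
      = - (\<Sum>y\<in>A. \<P>(\<omega> in \<Omega>. Y \<omega> = y \<and> Z \<omega> = z) / \<P>(\<omega> in \<Omega>. Z \<omega> = z)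
          * log 2 (\<P>(\<omega> in \<Omega>. Y \<omega> = y \<and> Z \<omega> = z) / \<P>(\<omega> in \<Omega>. Z \<omega> = z)))"
    and entropy_given_value_le_log_card: "entropy_given_value \<Omega> Y Z z \<le> log 2 (card A)"
proof -
  interpret prob_space \<Omega> by fact
  let ?E = "{\<omega> \<in> space \<Omega>. Z \<omega> = z}"
  let ?U = "uniform_measure \<Omega> ?E"
  \<comment> \<open>Non-measurable sets have measure 0, so positivity already yields
    measurability.\<close>
  have E: "?E \<in> events"
    using pos measure_notin_sets[of ?E \<Omega>] by fastforce
  have U: "prob_space ?U"
    using pos by (intro prob_space_uniform_measure) (auto simp: emeasure_eq_measure)
  have YU: "simple_function ?U Y"
    using Y by (simp add: simple_function_def)
  have "\<P>(\<omega> in ?U. Y \<omega> = y) = \<P>(\<omega> in \<Omega>. Y \<omega> = y \<and> Z \<omega> = z) / \<P>(\<omega> in \<Omega>. Z \<omega> = z)" for y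
  proof -
    have "{\<omega> \<in> space \<Omega>. Y \<omega> = y} = Y -` {y} \<inter> space \<Omega>" by auto
    then have "{\<omega> \<in> space \<Omega>. Y \<omega> = y} \<in> events"
      using simple_functionD(2)[OF Y, of "{y}"] by simp
    moreover have "?E \<inter> {\<omega> \<in> space \<Omega>. Y \<omega> = y} = {\<omega> \<in> space \<Omega>. Y \<omega> = y \<and> Z \<omega> = z}" by auto
    ultimately show ?thesis using pos E
      by (simp add: measure_uniform_measure emeasure_eq_measure)
  qed
  then show "entropy_given_value \<Omega> Y Z z
      = - (\<Sum>y\<in>A. \<P>(\<omega> in \<Omega>. Y \<omega> = y \<and> Z \<omega> = z) / \<P>(\<omega> in \<Omega>. Z \<omega> = z)
          * log 2 (\<P>(\<omega> in \<Omega>. Y \<omega> = y \<and> Z \<omega> = z) / \<P>(\<omega> in \<Omega>. Z \<omega> = z)))"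
    unfolding entropy_given_value_def using A
    by (subst entropy_bits_eq_sum[OF U YU, of A]) simp_all
  show "entropy_given_value \<Omega> Y Z z \<le> log 2 (card A)"
    unfolding entropy_given_value_def using A by (intro entropy_bits_le_log_card[OF U YU]) simp_all
qed

lemma mutual_information_bits_eq_sum:
  assumes "prob_space \<Omega>" and Y: "simple_function \<Omega> Y" and Z: "simple_function \<Omega> Z"
    and A: "finite A" "Y ` space \<Omega> \<subseteq> A" and B: "finite B" "Z ` space \<Omega> \<subseteq> B"
  shows "mutual_information_bits \<Omega> Y Z
    = (\<Sum>y\<in>A. \<Sum>z\<in>B. \<P>(\<omega> in \<Omega>. Y \<omega> = y \<and> Z \<omega> = z)
        * log 2 (\<P>(\<omega> in \<Omega>. Y \<omega> = y \<and> Z \<omega> = z)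
            / (\<P>(\<omega> in \<Omega>. Y \<omega> = y) * \<P>(\<omega> in \<Omega>. Z \<omega> = z))))"
proof -
  interpret prob_space \<Omega> by fact
  interpret information_space \<Omega> 2 by standard simp
  let ?PY = "\<lambda>y. \<P>(\<omega> in \<Omega>. Y \<omega> = y)" and ?PZ = "\<lambda>z. \<P>(\<omega> in \<Omega>. Z \<omega> = z)"
  let ?P = "\<lambda>u. \<P>(\<omega> in \<Omega>. Y \<omega> = fst u \<and> Z \<omega> = snd u)"
  let ?YZ = "\<lambda>\<omega>. (Y \<omega>, Z \<omega>)"
  have "simple_distributed \<Omega> Y ?PY" "simple_distributed \<Omega> Z ?PZ"
    using Y Z by (auto intro!: simple_distributedI arg_cong[where f = prob])
  moreover have "simple_distributed \<Omega> ?YZ ?P"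
    using simple_function_Pair[OF Y Z]
    by (rule simple_distributedI) (auto intro!: arg_cong[where f = prob])
  ultimately have "mutual_information_bits \<Omega> Y Z
      = (\<Sum>(y, z)\<in>?YZ ` space \<Omega>. ?P (y, z) * log 2 (?P (y, z) / (?PY y * ?PZ z)))"
    unfolding mutual_information_bits_def by (rule mutual_information_simple_distributed)
  \<comment> \<open>The joint range may be a proper part of the product of the two ranges, so even
    pairs of attained values can have joint mass 0.\<close>
  also have "\<dots> = (\<Sum>(y, z)\<in>A \<times> B. ?P (y, z) * log 2 (?P (y, z) / (?PY y * ?PZ z)))"
  proof (rule sum.mono_neutral_left)
    show "\<forall>u\<in>A \<times> B - ?YZ ` space \<Omega>.
        (case u of (y, z) \<Rightarrow> ?P (y, z) * log 2 (?P (y, z) / (?PY y * ?PZ z))) = 0"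
    proof
      fix u assume "u \<in> A \<times> B - ?YZ ` space \<Omega>"
      then have "{\<omega> \<in> space \<Omega>. Y \<omega> = fst u \<and> Z \<omega> = snd u} = {}" by (cases u) auto
      then have "?P u = 0" by (simp only: measure_empty)
      then show "(case u of (y, z) \<Rightarrow> ?P (y, z) * log 2 (?P (y, z) / (?PY y * ?PZ z))) = 0"
        by (cases u) simp
    qed
  qed (use A B in auto)
  finally show ?thesis by (simp add: sum.cartesian_product)
qed

lemma expectation_eq_sum:
  fixes f :: "'b \<Rightarrow> real"
  assumes "prob_space \<Omega>" and Y: "simple_function \<Omega> Y"
    and A: "finite A" "Y ` space \<Omega> \<subseteq> A"
  shows "(\<integral>\<omega>. f (Y \<omega>) \<partial>\<Omega>) = (\<Sum>y\<in>A. \<P>(\<omega> in \<Omega>. Y \<omega> = y) * f y)"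
proof -
  interpret prob_space \<Omega> by fact
  let ?E = "\<lambda>y. {\<omega> \<in> space \<Omega>. Y \<omega> = y}"
  have E: "?E y \<in> events" for y
  proof -
    have "?E y = Y -` {y} \<inter> space \<Omega>" by auto
    then show ?thesis using simple_functionD(2)[OF Y, of "{y}"] by simp
  qed
  \<comment> \<open>Pointwise, exactly one indicator is 1, the one at \<open>y = Y \<omega>\<close>;
    exchanging integral and finite sum then leaves the point masses.\<close>
  have "(\<integral>\<omega>. f (Y \<omega>) \<partial>\<Omega>) = (\<integral>\<omega>. (\<Sum>y\<in>A. indicat_real (?E y) \<omega> * f y) \<partial>\<Omega>)"
  proof (rule Bochner_Integration.integral_cong[OF refl])
    fix \<omega> assume \<omega>: "\<omega> \<in> space \<Omega>"
    have "(\<Sum>y\<in>A. indicat_real (?E y) \<omega> * f y) = (\<Sum>y\<in>A. if y = Y \<omega> then f y else 0)"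
      using \<omega> by (intro sum.cong) (auto simp: indicator_def)
    also have "\<dots> = f (Y \<omega>)" using A \<omega> by (subst sum.delta) auto
    finally show "f (Y \<omega>) = (\<Sum>y\<in>A. indicat_real (?E y) \<omega> * f y)" ..
  qed
  also have "\<dots> = (\<Sum>y\<in>A. \<integral>\<omega>. indicat_real (?E y) \<omega> * f y \<partial>\<Omega>)"
    using E by (intro Bochner_Integration.integral_sum) (auto simp: emeasure_eq_measure)
  also have "\<dots> = (\<Sum>y\<in>A. prob (?E y) * f y)"
    using E by (intro sum.cong) auto
  finally show ?thesis .
qed

lemma simple_functionI_finite:
  assumes "Y \<in> measurable \<Omega> (count_space A)" "finite A"
  shows "simple_function \<Omega> Y"
proof -
  have "simple_function (count_space A) (\<lambda>x. x)"
    using assms(2) by (simp add: simple_function_def)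
  from simple_function_comp[OF assms(1) this] show ?thesis by (simp add: comp_def)
qed

section \<open>Binary vectors\<close>

definition bit_vecs :: "nat \<Rightarrow> (nat \<Rightarrow> bit) set" where
  "bit_vecs M = {1..M} \<rightarrow>\<^sub>E UNIV"

text \<open>Addition of the unit vector. The restriction to \<open>{1..M}\<close> makes the result
  extensional, so that it lies in \<open>bit_vecs M\<close> and can be compared with queries by
  plain equality.\<close>

definition flip :: "nat \<Rightarrow> nat \<Rightarrow> (nat \<Rightarrow> bit) \<Rightarrow> nat \<Rightarrow> bit" where
  "flip M m q = (\<lambda>i\<in>{1..M}. q i + unit_vec m i)"

lemma finite_UNIV_bit: "finite (UNIV :: bit set)"
proof -
  have "(UNIV :: bit set) = {0, 1}" using bit.exhaust by auto
  then show ?thesis by (metis finite.emptyI finite.insertI)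
qed

lemma finite_bit_vecs [simp]: "finite (bit_vecs M)"
  unfolding bit_vecs_def by (intro finite_PiE) (simp_all add: finite_UNIV_bit)

lemma hamming_weight_le: "hamming_weight M q \<le> M"
  unfolding hamming_weight_def by (rule order.trans[OF card_mono[of "{1..M}"]]) auto

lemma card_zeros: "card {i \<in> {1..M}. q i = 0} = M - hamming_weight M q"
proof -
  have "card {i \<in> {1..M}. q i = 0} = card ({1..M} - {i \<in> {1..M}. q i \<noteq> 0})"
    by (rule arg_cong[where f = card]) auto
  also have "\<dots> = card {1..M} - card {i \<in> {1..M}. q i \<noteq> 0}"
    by (rule card_Diff_subset) auto
  finally show ?thesis by (simp add: hamming_weight_def)
qed

text \<open>A vector is determined by its support, so the count is that of the
  \<open>w\<close>-element subsets of \<open>{1..M}\<close>.\<close>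

lemma card_bit_vecs_weight: "card {q \<in> bit_vecs M. hamming_weight M q = w} = M choose w"
proof -
  let ?s = "\<lambda>q. {i \<in> {1..M}. (q :: nat \<Rightarrow> bit) i \<noteq> 0}"
  have "bij_betw ?s {q \<in> bit_vecs M. hamming_weight M q = w}
      {K. K \<subseteq> {1..M} \<and> card K = w}"
  proof (rule bij_betw_byWitness[where f' = "\<lambda>K. \<lambda>i\<in>{1..M}. if i \<in> K then 1 else 0"])
    show "\<forall>q\<in>{q \<in> bit_vecs M. hamming_weight M q = w}.
        (\<lambda>i\<in>{1..M}. if i \<in> ?s q then 1 else 0) = q"
      by (auto simp: bit_vecs_def fun_eq_iff PiE_def extensional_def)
    show "\<forall>K\<in>{K. K \<subseteq> {1..M} \<and> card K = w}.
        ?s (\<lambda>i\<in>{1..M}. if i \<in> K then 1 else 0) = K"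
      by (auto split: if_splits)
    show "?s ` {q \<in> bit_vecs M. hamming_weight M q = w} \<subseteq> {K. K \<subseteq> {1..M} \<and> card K = w}"
      by (auto simp: hamming_weight_def)
    show "(\<lambda>K. \<lambda>i\<in>{1..M}. if i \<in> K then 1 else 0) ` {K. K \<subseteq> {1..M} \<and> card K = w}
        \<subseteq> {q \<in> bit_vecs M. hamming_weight M q = w}"
    proof safe
      fix K assume K: "K \<subseteq> {1..M}" "w = card K"
      have "{i \<in> {1..M}. (\<lambda>i\<in>{1..M}. if i \<in> K then 1 else (0::bit)) i \<noteq> 0} = K"
        using K by (auto split: if_splits)
      then show "hamming_weight M (\<lambda>i\<in>{1..M}. if i \<in> K then 1 else 0) = card K"
        unfolding hamming_weight_def by simp
    qed (auto simp: bit_vecs_def)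
  qed
  then have "card {q \<in> bit_vecs M. hamming_weight M q = w}
      = card {K. K \<subseteq> {1..M} \<and> card K = w}"
    by (rule bij_betw_same_card)
  also have "\<dots> = M choose w" by (subst n_subsets) auto
  finally show ?thesis .
qed

lemma ex_bit_vec:
  assumes "w \<le> M"
  obtains q where "q \<in> bit_vecs M" "hamming_weight M q = w"
proof -
  have "card {q \<in> bit_vecs M. hamming_weight M q = w} \<noteq> 0"
    using assms by (simp add: card_bit_vecs_weight)
  then have "{q \<in> bit_vecs M. hamming_weight M q = w} \<noteq> {}"
    by (metis card.empty)
  then show ?thesis using that by auto
qed

lemma sum_bit_vecs_weight:
  fixes f :: "nat \<Rightarrow> real"
  shows "(\<Sum>q\<in>bit_vecs M. f (hamming_weight M q)) = (\<Sum>w=0..M. real (M choose w) * f w)"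
proof -
  have "(\<Sum>q\<in>bit_vecs M. f (hamming_weight M q))
      = (\<Sum>w\<in>{0..M}. \<Sum>q\<in>{q \<in> bit_vecs M. hamming_weight M q = w}. f (hamming_weight M q))"
    using hamming_weight_le by (intro sum.group[symmetric]) auto
  also have "\<dots> = (\<Sum>w=0..M. real (M choose w) * f w)"
    by (intro sum.cong refl) (simp add: card_bit_vecs_weight)
  finally show ?thesis .
qed

text \<open>Summands that see \<open>m\<close> only through \<open>q m\<close> are the typical case:
  this gives both the average of the flipped masses and the entropy of the posterior of the
  index.\<close>

lemma sum_bit_cases:
  fixes a b :: real
  shows "(\<Sum>m=1..M. if (q :: nat \<Rightarrow> bit) m = 0 then a else b)
    = real (M - hamming_weight M q) * a + real (hamming_weight M q) * b"
proof -
  have "{1..M} \<inter> - {m. q m = 0} = {i \<in> {1..M}. q i \<noteq> 0}"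
    "{1..M} \<inter> {m. q m = 0} = {i \<in> {1..M}. q i = 0}" by auto
  then show ?thesis
    by (subst sum.If_cases) (simp_all only: card_zeros sum_constant finite_atLeastAtMost flip: hamming_weight_def)
qed

section \<open>Adding a unit vector: involution, weight, averaged masses\<close>

lemma flip_in_bit_vecs [simp]: "flip M m q \<in> bit_vecs M"
  by (simp add: flip_def bit_vecs_def)

text \<open>In characteristic 2 a unit vector added twice cancels, so each flip is its own
  inverse.\<close>

lemma flip_flip: "q \<in> bit_vecs M \<Longrightarrow> flip M m (flip M m q) = q"
  by (auto simp: flip_def bit_vecs_def fun_eq_iff PiE_def extensional_def unit_vec_def)

lemma bij_betw_flip: "bij_betw (flip M m) (bit_vecs M) (bit_vecs M)"
  by (rule bij_betw_byWitness[where f' = "flip M m"]) (auto simp: flip_flip)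

text \<open>The subtraction is exact: if \<open>q m\<close> is nonzero with \<open>m\<close> in
  range, the weight is at least 1.\<close>

lemma hamming_weight_flip:
  assumes "m \<in> {1..M}"
  shows "hamming_weight M (flip M m q)
    = (if q m = 0 then hamming_weight M q + 1 else hamming_weight M q - 1)"
proof -
  let ?K = "{i \<in> {1..M}. q i \<noteq> 0}"
  have "{i \<in> {1..M}. flip M m q i \<noteq> 0} = (if q m = 0 then insert m ?K else ?K - {m})"
    using assms by (auto simp: flip_def unit_vec_def split: if_splits)
  then show ?thesis
    unfolding hamming_weight_def using assms by (auto simp: card_insert_if simp del: bit_not_zero_iff)
qed

text \<open>The origin of \<open>g_B\<close>: for a fixed index \<open>m\<close> the first query
  equals \<open>q\<close> when the random vector is \<open>flip M m q\<close>, and the index is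
  uniform. Zeros of \<open>q\<close> contribute weight \<open>w + 1\<close>, the support contributes
  weight \<open>w - 1\<close>.\<close>

lemma average_flip_h:
  assumes "1 \<le> M"
  shows "(\<Sum>m=1..M. h_B M (hamming_weight M (flip M m q)) p) / M = g_B M (hamming_weight M q) p"
proof -
  let ?w = "hamming_weight M q"
  have w: "?w \<le> M" by (rule hamming_weight_le)
  have "(\<Sum>m=1..M. h_B M (hamming_weight M (flip M m q)) p)
     = (\<Sum>m=1..M. if q m = 0 then h_B M (?w + 1) p else h_B M (?w - 1) p)"
    by (intro sum.cong refl) (auto simp: hamming_weight_flip)
  also have "\<dots> = real (M - ?w) * h_B M (?w + 1) p + real ?w * h_B M (?w - 1) p"
    by (rule sum_bit_cases)
  \<comment> \<open>At weight 0 the truncated exponent \<open>M - (w - 1)\<close> is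
    \<open>M\<close> and not \<open>M + 1\<close>; the prefactor 0 hides the mismatch.\<close>
  also have "real ?w * h_B M (?w - 1) p = real ?w * ((1 - p) ^ (M - ?w + 1) * p ^ (?w - 1))"
    using w by (cases "?w = 0") (auto simp: h_B_def Suc_diff_le)
  finally show ?thesis by (simp add: g_B_def h_B_def)
qed

section \<open>Closed forms\<close>

lemma sum_h: "(\<Sum>q\<in>bit_vecs M. h_B M (hamming_weight M q) p) = 1"
proof -
  have "(\<Sum>q\<in>bit_vecs M. h_B M (hamming_weight M q) p)
      = (\<Sum>w\<le>M. real (M choose w) * p ^ w * (1 - p) ^ (M - w))"
    by (subst sum_bit_vecs_weight) (simp add: h_B_def atMost_atLeast0 mult_ac)
  also have "\<dots> = 1" using binomial_ring[of p "1 - p" M] by simp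
  finally show ?thesis .
qed

text \<open>The factor \<open>h_B\<close> stays on both sides so that the identity survives
  \<open>p = 0\<close> with \<open>0 < w\<close>, where the logarithm of the product does not
  split.\<close>

lemma h_log_h:
  assumes "0 \<le> p" "p < 1"
  shows "h_B M w p * log 2 (h_B M w p)
    = h_B M w p * (real (M - w) * log 2 (1 - p) + real w * log 2 p)"
proof (cases "h_B M w p = 0")
  case False
  then have "w = 0 \<or> 0 < p" using assms by (auto simp: h_B_def)
  then show ?thesis
    using assms by (auto simp: h_B_def log_mult log_nat_power)
qed simp

lemma sum_h_log_h:
  assumes "0 \<le> p" "p < 1"
  shows "(\<Sum>q\<in>bit_vecs M. h_B M (hamming_weight M q) p * log 2 (h_B M (hamming_weight M q) p))
    = - real M * binary_entropy p"
proof -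
  let ?L = "log 2 (1 - p)" and ?K = "log 2 p"
  let ?B = "\<lambda>w. Bernstein M w p"
  have "(\<Sum>q\<in>bit_vecs M. h_B M (hamming_weight M q) p * log 2 (h_B M (hamming_weight M q) p))
      = (\<Sum>w\<le>M. real (M choose w) * (h_B M w p * log 2 (h_B M w p)))"
    by (subst sum_bit_vecs_weight) (simp add: atMost_atLeast0)
  \<comment> \<open>With \<open>M - w\<close> written as a difference, the logarithm is affine in
    \<open>w\<close>. The Bernstein polynomials are the binomial masses, with total 1 and mean
    \<open>M * p\<close>.\<close>
  also have "\<dots> = (\<Sum>w\<le>M. ?B w * (real M * ?L) + real w * ?B w * (?K - ?L))"
    by (intro sum.cong refl, subst h_log_h[OF assms])
      (simp add: Bernstein_def h_B_def of_nat_diff algebra_simps)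
  also have "\<dots> = real M * ?L + real M * p * (?K - ?L)"
    by (simp add: sum.distrib flip: sum_distrib_right)
  finally show ?thesis by (simp add: binary_entropy_def algebra_simps)
qed

text \<open>The function \<open>f\<close> is left general because two instances are needed: the
  identity for normalisation and \<open>x * log 2 x\<close> for the entropy.\<close>

lemma sum_pmf_B:
  assumes "w \<le> M"
  shows "(\<Sum>m=1..M. f (pmf_B M w p m))
    = real (M - w) * f ((1 - p) ^ (M - w - 1) * p ^ (w + 1) / (real M * g_B M w p))
      + real w * f ((1 - p) ^ (M - w + 1) * p ^ (w - 1) / (real M * g_B M w p))" (is "_ = _ * ?a + _ * ?b")
proof -
  have "{1..M} = {1..M - w} \<union> {M - w + 1..M}" using assms by auto
  then have "(\<Sum>m=1..M. f (pmf_B M w p m))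
      = (\<Sum>m=1..M-w. f (pmf_B M w p m)) + (\<Sum>m=M-w+1..M. f (pmf_B M w p m))"
    by (simp only:) (subst sum.union_disjoint, auto)
  also have "(\<Sum>m=1..M-w. f (pmf_B M w p m)) = (\<Sum>m=1..M-w. ?a)"
    by (intro sum.cong refl) (simp add: pmf_B_def)
  also have "(\<Sum>m=M-w+1..M. f (pmf_B M w p m)) = (\<Sum>m=M-w+1..M. ?b)"
    by (intro sum.cong refl) (simp add: pmf_B_def)
  finally show ?thesis using assms by simp
qed

text \<open>The sum of the unnormalised masses is \<open>M * g_B M w p\<close>; positivity of
  \<open>g_B\<close> therefore makes the point measure a probability space, and the general entropy
  formula applies to its identity map.\<close>

lemma entropy_B_eq_sum:
  assumes "1 \<le> M" "w \<le> M" "0 \<le> p" "p \<le> 1" "0 < g_B M w p"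
  shows "entropy_B M w p = - (\<Sum>m=1..M. pmf_B M w p m * log 2 (pmf_B M w p m))"
proof -
  let ?N = "point_measure {1..M} (\<lambda>m. ennreal (pmf_B M w p m))"
  have nn: "0 \<le> pmf_B M w p m" for m using assms by (simp add: pmf_B_def)
  have "(\<Sum>m=1..M. pmf_B M w p m) = 1"
  proof -
    let ?a = "(1 - p) ^ (M - w - 1) * p ^ (w + 1)" and ?b = "(1 - p) ^ (M - w + 1) * p ^ (w - 1)"
    let ?c = "real M * g_B M w p"
    have "(\<Sum>m=1..M. pmf_B M w p m) = real (M - w) * (?a / ?c) + real w * (?b / ?c)"
      by (rule sum_pmf_B[OF assms(2)])
    also have "\<dots> = (real (M - w) * ?a + real w * ?b) / ?c"
      by (simp only: add_divide_distrib times_divide_eq_right)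
    also have "real (M - w) * ?a + real w * ?b = ?c"
      using assms(1) by (simp add: g_B_def mult.assoc)
    finally show ?thesis using assms(1,5) by simp
  qed
  then have "(\<Sum>m=1..M. ennreal (pmf_B M w p m)) = 1"
    using nn by (subst sum_ennreal) auto
  then have N: "prob_space ?N" by (intro prob_space_point_measure) auto
  have sp: "space ?N = {1..M}" by (simp add: space_point_measure)
  have "simple_function ?N (\<lambda>m. m)"
    unfolding simple_function_def by (auto simp: sp sets_point_measure simp del: One_nat_def)
  then have "entropy_B M w p = - (\<Sum>m=1..M. \<P>(k in ?N. k = m) * log 2 (\<P>(k in ?N. k = m)))"
    unfolding entropy_B_def by (intro entropy_bits_eq_sum[OF N]) (simp_all add: sp del: One_nat_def)
  moreover have "\<P>(k in ?N. k = m) = pmf_B M w p m" if "m \<in> {1..M}" for m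
  proof -
    have "{k \<in> space ?N. k = m} = {m}" using that sp by auto
    then show ?thesis
      using that nn by (simp add: measure_def emeasure_point_measure_finite)
  qed
  ultimately show ?thesis by simp
qed

lemma Max_servers: "Max (f ` {1, 2 :: nat}) = max (f 1) (f 2)"
  for f :: "nat \<Rightarrow> real"
  by simp

section \<open>Distribution of the queries\<close>

locale bernoulli_scheme_B = prob_space \<Omega>
  for \<Omega> :: "'a measure" and M :: nat and p :: real
    and idx :: "'a \<Rightarrow> nat" and S X :: "nat \<Rightarrow> 'a \<Rightarrow> bit" +
  assumes M: "1 \<le> M" and p: "0 \<le> p" "p \<le> 1 / 2"
    and scheme: "scheme_B \<Omega> M idx S X" and iid: "iid_bernoulli \<Omega> M S p"
begin

lemma idx_measurable: "idx \<in> measurable \<Omega> (count_space {1..M})"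
  using scheme by (simp add: scheme_B_def)

lemma idx_in: "\<omega> \<in> space \<Omega> \<Longrightarrow> idx \<omega> \<in> {1..M}"
  using measurable_space[OF idx_measurable] by simp

lemma simple_idx: "simple_function \<Omega> idx"
  using idx_measurable by (rule simple_functionI_finite) simp

lemma rand_vec_in: "rand_vec M S \<omega> \<in> bit_vecs M"
  by (simp add: rand_vec_def bit_vecs_def)

lemma S_measurable: "i \<in> {1..M} \<Longrightarrow> S i \<in> measurable \<Omega> (count_space UNIV)"
  using scheme by (simp add: scheme_B_def)

lemma rand_vec_eq_Inter:
  assumes "q \<in> bit_vecs M"
  shows "{\<omega> \<in> space \<Omega>. rand_vec M S \<omega> = q} = (\<Inter>i\<in>{1..M}. S i -` {q i} \<inter> space \<Omega>)"
proof -
  have "rand_vec M S \<omega> = q \<longleftrightarrow> (\<forall>i\<in>{1..M}. S i \<omega> = q i)" for \<omega>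
    using assms by (auto simp: rand_vec_def bit_vecs_def fun_eq_iff PiE_def extensional_def)
  \<comment> \<open>\<open>M\<close> excludes the empty intersection, which would be the whole type
    instead of \<open>space \<Omega>\<close>.\<close>
  then show ?thesis using M by (auto simp del: atLeastAtMost_iff)
qed

lemma rand_vec_measurable: "rand_vec M S \<in> measurable \<Omega> (count_space (bit_vecs M))"
proof (subst measurable_count_space_eq2, simp, intro conjI ballI)
  fix q assume q: "q \<in> bit_vecs M"
  have "rand_vec M S -` {q} \<inter> space \<Omega> = {\<omega> \<in> space \<Omega>. rand_vec M S \<omega> = q}" by auto
  also have "\<dots> \<in> events"
    unfolding rand_vec_eq_Inter[OF q] using M S_measurable
    by (intro sets.finite_INT) (auto intro: measurable_sets)
  finally show "rand_vec M S -` {q} \<inter> space \<Omega> \<in> events" .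
qed (simp add: rand_vec_in)

lemma prob_idx: "m \<in> {1..M} \<Longrightarrow> \<P>(\<omega> in \<Omega>. idx \<omega> = m) = 1 / M"
proof -
  assume m: "m \<in> {1..M}"
  have "{\<omega> \<in> space \<Omega>. idx \<omega> = m} = idx -` {m} \<inter> space \<Omega>" by auto
  then have "\<P>(\<omega> in \<Omega>. idx \<omega> = m) = measure (distr \<Omega> (count_space {1..M}) idx) {m}"
    using m by (subst measure_distr[OF idx_measurable]) simp_all
  also have "\<dots> = measure (uniform_count_measure {1..M}) {m}"
    using scheme by (simp add: scheme_B_def)
  also have "\<dots> = 1 / M" using m by (subst measure_uniform_count_measure) auto
  finally show ?thesis .
qed

lemma prob_S:
  assumes "i \<in> {1..M}"
  shows "prob (S i -` {b} \<inter> space \<Omega>) = (if b = 0 then 1 - p else p)"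
proof -
  have [measurable]: "S i \<in> measurable \<Omega> (count_space UNIV)" using S_measurable assms .
  have eq: "S i -` {b} \<inter> space \<Omega> = {\<omega> \<in> space \<Omega>. S i \<omega> = b}" for b by auto
  have 1: "prob {\<omega> \<in> space \<Omega>. S i \<omega> = 1} = p"
    using iid assms by (simp add: iid_bernoulli_def)
  have "{\<omega> \<in> space \<Omega>. S i \<omega> = 0} = {\<omega> \<in> space \<Omega>. \<not> S i \<omega> = 1}" by auto
  then have "prob {\<omega> \<in> space \<Omega>. S i \<omega> = 0} = 1 - p"
    using prob_neg[of "\<lambda>\<omega>. S i \<omega> = 1"] 1 by simp
  with 1 show ?thesis unfolding eq by (cases b) auto
qed

lemma prob_rand_vec:
  assumes "q \<in> bit_vecs M"
  shows "\<P>(\<omega> in \<Omega>. rand_vec M S \<omega> = q) = h_B M (hamming_weight M q) p"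
proof -
  have "indep_sets (\<lambda>i. {S i -` A \<inter> space \<Omega> | A. A \<in> sets (count_space UNIV)}) {1..M}"
    using iid by (simp add: iid_bernoulli_def indep_vars_def2)
  then have "prob (\<Inter>i\<in>{1..M}. S i -` {q i} \<inter> space \<Omega>)
      = (\<Prod>i\<in>{1..M}. prob (S i -` {q i} \<inter> space \<Omega>))"
    by (rule indep_setsD) (use M in auto)
  also have "\<dots> = (\<Prod>i\<in>{1..M}. if q i = 0 then 1 - p else p)"
    by (intro prod.cong refl prob_S)
  also have "\<dots> = h_B M (hamming_weight M q) p"
  proof -
    have "{1..M} \<inter> - {m. q m = 0} = {i \<in> {1..M}. q i \<noteq> 0}"
      "{1..M} \<inter> {m. q m = 0} = {i \<in> {1..M}. q i = 0}" by auto
    then show ?thesis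
      by (subst prod.If_cases)
        (simp_all only: card_zeros prod_constant finite_atLeastAtMost h_B_def flip: hamming_weight_def)
  qed
  finally show ?thesis unfolding rand_vec_eq_Inter[OF assms] .
qed

lemma prob_idx_rand_vec:
  assumes "m \<in> {1..M}" "q \<in> bit_vecs M"
  shows "\<P>(\<omega> in \<Omega>. idx \<omega> = m \<and> rand_vec M S \<omega> = q) = h_B M (hamming_weight M q) p / M"
proof -
  let ?F = "\<lambda>k. case k of Index \<Rightarrow> rv_events \<Omega> idx
              | Randomness \<Rightarrow> rv_events \<Omega> (rand_vec M S)
              | File m \<Rightarrow> rv_events \<Omega> (X m)"
  \<comment> \<open>Independence is applied to the subfamily of index and random vector; the value
    at \<open>File\<close> is a filler that makes the function total.\<close>
  let ?A = "\<lambda>k. case k of Index \<Rightarrow> idx -` {m} \<inter> space \<Omega>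
              | Randomness \<Rightarrow> rand_vec M S -` {q} \<inter> space \<Omega> | File m \<Rightarrow> {}"
  have "indep_sets ?F ({Index, Randomness} \<union> File ` {1..M})"
    using scheme by (simp add: scheme_B_def)
  then have "prob (\<Inter>k\<in>{Index, Randomness}. ?A k) = (\<Prod>k\<in>{Index, Randomness}. prob (?A k))"
    by (rule indep_setsD) (auto simp: rv_events_def)
  moreover have "(\<Inter>k\<in>{Index, Randomness}. ?A k)
      = {\<omega> \<in> space \<Omega>. idx \<omega> = m \<and> rand_vec M S \<omega> = q}"
    and "?A Index = {\<omega> \<in> space \<Omega>. idx \<omega> = m}"
    and "?A Randomness = {\<omega> \<in> space \<Omega>. rand_vec M S \<omega> = q}" by auto
  ultimately show ?thesis using prob_idx prob_rand_vec assms by simp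
qed

section \<open>Joint and marginal laws of index and queries\<close>

lemma query_1: "query M idx S 1 \<omega> = flip M (idx \<omega>) (rand_vec M S \<omega>)"
  by (auto simp: query_def flip_def rand_vec_def)

lemma query_2: "query M idx S 2 = rand_vec M S"
  by (auto simp: query_def)

lemma query_in: "query M idx S l \<omega> \<in> bit_vecs M"
  by (simp add: query_def rand_vec_def bit_vecs_def)

lemma simple_rand_vec: "simple_function \<Omega> (rand_vec M S)"
  using rand_vec_measurable by (rule simple_functionI_finite) simp

lemma simple_query:
  assumes "l \<in> {1, 2}"
  shows "simple_function \<Omega> (query M idx S l)"
proof -
  have "simple_function \<Omega> (\<lambda>\<omega>. flip M (idx \<omega>) (rand_vec M S \<omega>))"
    using simple_idx simple_rand_vec by (rule simple_function_compose2)
  then have "simple_function \<Omega> (query M idx S 1)"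
    by (simp only: query_1[abs_def])
  moreover have "simple_function \<Omega> (query M idx S 2)"
    using simple_rand_vec by (simp only: query_2)
  ultimately show ?thesis using assms by blast
qed

text \<open>For a fixed index the query equation has a unique solution for the random vector, namely
  \<open>flip M m q\<close>, so the joint law of index and random vector applies there.\<close>

lemma prob_idx_query_1:
  assumes "m \<in> {1..M}" "q \<in> bit_vecs M"
  shows "\<P>(\<omega> in \<Omega>. idx \<omega> = m \<and> query M idx S 1 \<omega> = q)
    = h_B M (hamming_weight M (flip M m q)) p / M"
proof -
  have "idx \<omega> = m \<and> query M idx S 1 \<omega> = q \<longleftrightarrow> idx \<omega> = m \<and> rand_vec M S \<omega> = flip M m q" for \<omega>
    using flip_flip[OF assms(2)] flip_flip[OF rand_vec_in] by (auto simp: query_1 simp del: One_nat_def)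
  then show ?thesis using assms by (simp add: prob_idx_rand_vec)
qed

lemma prob_query_1:
  assumes "q \<in> bit_vecs M"
  shows "\<P>(\<omega> in \<Omega>. query M idx S 1 \<omega> = q) = g_B M (hamming_weight M q) p"
proof -
  let ?Q = "query M idx S 1"
  have ev: "{\<omega> \<in> space \<Omega>. idx \<omega> = m \<and> ?Q \<omega> = q} \<in> events" for m
  proof -
    have "{\<omega> \<in> space \<Omega>. idx \<omega> = m \<and> ?Q \<omega> = q} = (\<lambda>\<omega>. (idx \<omega>, ?Q \<omega>)) -` {(m, q)} \<inter> space \<Omega>" by auto
    then show ?thesis
      using simple_functionD(2)[OF simple_function_Pair[OF simple_idx simple_query[of 1]]] by simp
  qed
  have "{\<omega> \<in> space \<Omega>. ?Q \<omega> = q} = (\<Union>m\<in>{1..M}. {\<omega> \<in> space \<Omega>. idx \<omega> = m \<and> ?Q \<omega> = q})"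
    using idx_in by auto
  then have "\<P>(\<omega> in \<Omega>. ?Q \<omega> = q) = (\<Sum>m=1..M. \<P>(\<omega> in \<Omega>. idx \<omega> = m \<and> ?Q \<omega> = q))"
    using ev by (simp only:) (intro finite_measure_finite_Union, auto simp: disjoint_family_on_def)
  also have "\<dots> = (\<Sum>m=1..M. h_B M (hamming_weight M (flip M m q)) p / M)"
    using assms by (intro sum.cong prob_idx_query_1) auto
  finally show ?thesis using average_flip_h[OF M] by (simp flip: sum_divide_distrib)
qed

lemma query_image: "query M idx S l ` space \<Omega> \<subseteq> bit_vecs M"
  using query_in by auto

lemma idx_image: "idx ` space \<Omega> \<subseteq> {1..M}"
  using idx_in by auto

lemma prob_query_2:
  "q \<in> bit_vecs M \<Longrightarrow> \<P>(\<omega> in \<Omega>. query M idx S 2 \<omega> = q) = h_B M (hamming_weight M q) p"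
  unfolding query_2 by (rule prob_rand_vec)

lemma prob_idx_query_2:
  assumes "m \<in> {1..M}" "q \<in> bit_vecs M"
  shows "\<P>(\<omega> in \<Omega>. idx \<omega> = m \<and> query M idx S 2 \<omega> = q) = h_B M (hamming_weight M q) p / M"
  unfolding query_2 using assms by (rule prob_idx_rand_vec)

lemma p_less_1: "p < 1"
  using p by simp

lemma h_nonneg: "0 \<le> h_B M w p"
  using p by (simp add: h_B_def)

text \<open>For \<open>m\<close> in range the left side is minus the entropy of the first query
  given index \<open>m\<close>.\<close>

lemma sum_flip_h_log_h:
  "(\<Sum>q\<in>bit_vecs M. h_B M (hamming_weight M (flip M m q)) p
      * log 2 (h_B M (hamming_weight M (flip M m q)) p)) = - real M * binary_entropy p"
  unfolding sum_h_log_h[OF p(1) p_less_1, symmetric]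
  by (rule sum.reindex_bij_betw[OF bij_betw_flip,
        where g = "\<lambda>q. h_B M (hamming_weight M q) p * log 2 (h_B M (hamming_weight M q) p)"])

section \<open>Costs and leakages\<close>

theorem rate_eq: "rate \<Omega> file_length (answer_length M idx S X) = 1 / 2"
  by (simp add: rate_def file_length_def answer_length_def answer_def prob_space)

section \<open>Query entropies, upload cost and access complexity\<close>

lemma entropy_query_1:
  "entropy_bits \<Omega> (query M idx S 1)
    = - (\<Sum>q\<in>bit_vecs M. g_B M (hamming_weight M q) p * log 2 (g_B M (hamming_weight M q) p))"
proof -
  have "entropy_bits \<Omega> (query M idx S 1)
      = - (\<Sum>q\<in>bit_vecs M. \<P>(\<omega> in \<Omega>. query M idx S 1 \<omega> = q)
            * log 2 (\<P>(\<omega> in \<Omega>. query M idx S 1 \<omega> = q)))"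
    by (intro entropy_bits_eq_sum prob_space_axioms simple_query query_image) auto
  then show ?thesis by (simp only: prob_query_1 cong: sum.cong)
qed

lemma entropy_query_2: "entropy_bits \<Omega> (query M idx S 2) = real M * binary_entropy p"
proof -
  have "entropy_bits \<Omega> (query M idx S 2)
      = - (\<Sum>q\<in>bit_vecs M. \<P>(\<omega> in \<Omega>. query M idx S 2 \<omega> = q)
            * log 2 (\<P>(\<omega> in \<Omega>. query M idx S 2 \<omega> = q)))"
    by (intro entropy_bits_eq_sum prob_space_axioms simple_query query_image) auto
  also have "\<dots> = - (\<Sum>q\<in>bit_vecs M. h_B M (hamming_weight M q) p
      * log 2 (h_B M (hamming_weight M q) p))"
    by (simp only: prob_query_2 cong: sum.cong)
  finally show ?thesis using sum_h_log_h[OF p(1) p_less_1] by simp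
qed

theorem upload_cost_eq: "upload_cost \<Omega> (query M idx S) = upload_B M p"
proof -
  have "upload_cost \<Omega> (query M idx S)
      = entropy_bits \<Omega> (query M idx S 1) + entropy_bits \<Omega> (query M idx S 2)"
    by (simp add: upload_cost_def)
  also have "entropy_bits \<Omega> (query M idx S 1)
      = - (\<Sum>w=0..M. real (M choose w) * (g_B M w p * log 2 (g_B M w p)))"
    unfolding entropy_query_1 by (subst sum_bit_vecs_weight) simp
  finally show ?thesis by (simp add: upload_B_def entropy_query_2 mult.assoc)
qed

theorem access_complexity_eq:
  "access_complexity \<Omega> (query M idx S) (hamming_weight M)
    = (\<Sum>w=0..M. real w * real (M choose w) * (g_B M w p + h_B M w p))"
proof -
  have E: "(\<integral>\<omega>. real (hamming_weight M (query M idx S l \<omega>)) \<partial>\<Omega>)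
      = (\<Sum>q\<in>bit_vecs M. \<P>(\<omega> in \<Omega>. query M idx S l \<omega> = q) * real (hamming_weight M q))"
    if "l \<in> {1, 2}" for l
    using that by (intro expectation_eq_sum prob_space_axioms simple_query query_image) auto
  have "(\<integral>\<omega>. real (hamming_weight M (query M idx S 1 \<omega>)) \<partial>\<Omega>)
      = (\<Sum>q\<in>bit_vecs M. g_B M (hamming_weight M q) p * real (hamming_weight M q))"
    by (simp only: E insertI1 prob_query_1 cong: sum.cong)
  also have "\<dots> = (\<Sum>w=0..M. real (M choose w) * (g_B M w p * real w))"
    by (rule sum_bit_vecs_weight)
  finally have 1: "(\<integral>\<omega>. real (hamming_weight M (query M idx S 1 \<omega>)) \<partial>\<Omega>) = \<dots>" .
  have "(\<integral>\<omega>. real (hamming_weight M (query M idx S 2 \<omega>)) \<partial>\<Omega>)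
      = (\<Sum>q\<in>bit_vecs M. h_B M (hamming_weight M q) p * real (hamming_weight M q))"
    by (simp only: E insertI1 insertI2 prob_query_2 cong: sum.cong)
  also have "\<dots> = (\<Sum>w=0..M. real (M choose w) * (h_B M w p * real w))"
    by (rule sum_bit_vecs_weight)
  finally have 2: "(\<integral>\<omega>. real (hamming_weight M (query M idx S 2 \<omega>)) \<partial>\<Omega>) = \<dots>" .
  have "access_complexity \<Omega> (query M idx S) (hamming_weight M)
      = (\<integral>\<omega>. real (hamming_weight M (query M idx S 1 \<omega>)) \<partial>\<Omega>)
        + (\<integral>\<omega>. real (hamming_weight M (query M idx S 2 \<omega>)) \<partial>\<Omega>)"
    by (simp add: access_complexity_def)
  then show ?thesis unfolding 1 2 by (simp add: algebra_simps flip: sum.distrib)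
qed

section \<open>Mutual information leakage\<close>

lemma mutual_information_query_1:
  "mutual_information_bits \<Omega> idx (query M idx S 1)
    = entropy_bits \<Omega> (query M idx S 1) - real M * binary_entropy p"
proof -
  let ?h = "\<lambda>m q. h_B M (hamming_weight M (flip M m q)) p"
  let ?g = "\<lambda>q. g_B M (hamming_weight M q) p"
  have "mutual_information_bits \<Omega> idx (query M idx S 1)
      = (\<Sum>m=1..M. \<Sum>q\<in>bit_vecs M. \<P>(\<omega> in \<Omega>. idx \<omega> = m \<and> query M idx S 1 \<omega> = q)
        * log 2 (\<P>(\<omega> in \<Omega>. idx \<omega> = m \<and> query M idx S 1 \<omega> = q)
            / (\<P>(\<omega> in \<Omega>. idx \<omega> = m) * \<P>(\<omega> in \<Omega>. query M idx S 1 \<omega> = q))))"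
    by (intro mutual_information_bits_eq_sum prob_space_axioms simple_query simple_idx
        query_image idx_image) auto
  also have "\<dots> = (\<Sum>m=1..M. \<Sum>q\<in>bit_vecs M. ?h m q / M * log 2 (?h m q / M / (1 / M * ?g q)))"
    by (simp only: prob_query_1 prob_idx prob_idx_query_1 cong: sum.cong)
  also have "\<dots> = (\<Sum>m=1..M. \<Sum>q\<in>bit_vecs M.
      ?h m q * log 2 (?h m q) / M - ?h m q / M * log 2 (?g q))"
  proof (intro sum.cong refl)
    fix m q assume m: "m \<in> {1..M}"
    show "?h m q / M * log 2 (?h m q / M / (1 / M * ?g q))
        = ?h m q * log 2 (?h m q) / M - ?h m q / M * log 2 (?g q)"
    proof (cases "?h m q = 0")
      \<comment> \<open>Splitting the logarithm of the quotient needs \<open>?g q\<close> positive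
        as well: it is an average of nonnegative masses, one of which is positive.\<close>
      case False
      then have h: "0 < ?h m q" using h_nonneg[of "hamming_weight M (flip M m q)"] by linarith
      also have "\<dots> \<le> (\<Sum>m=1..M. ?h m q)"
        using m h_nonneg by (intro member_le_sum) auto
      finally have "0 < ?g q" using M by (simp flip: average_flip_h)
      moreover have "?h m q / M / (1 / M * ?g q) = ?h m q / ?g q" using M by simp
      ultimately show ?thesis using h by (simp add: log_divide diff_divide_distrib algebra_simps)
    qed simp
  qed
  \<comment> \<open>The first sum averages the conditional entropies over the index. In the second,
    exchanging the sums puts the average over the index inside, and that average is
    \<open>?g q\<close>.\<close>
  also have "\<dots> = (\<Sum>m=1..M. (\<Sum>q\<in>bit_vecs M. ?h m q * log 2 (?h m q)) / M)
      - (\<Sum>m=1..M. \<Sum>q\<in>bit_vecs M. ?h m q / M * log 2 (?g q))"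
    by (simp only: sum_subtractf sum_divide_distrib)
  also have "(\<Sum>m=1..M. (\<Sum>q\<in>bit_vecs M. ?h m q * log 2 (?h m q)) / M)
      = - real M * binary_entropy p"
    unfolding sum_flip_h_log_h using M by simp
  also have "(\<Sum>m=1..M. \<Sum>q\<in>bit_vecs M. ?h m q / M * log 2 (?g q))
      = (\<Sum>q\<in>bit_vecs M. (\<Sum>m=1..M. ?h m q) / M * log 2 (?g q))"
    by (subst sum.swap) (simp only: sum_distrib_right sum_divide_distrib)
  finally show ?thesis unfolding entropy_query_1 average_flip_h[OF M] by simp
qed

lemma mutual_information_query_2: "mutual_information_bits \<Omega> idx (query M idx S 2) = 0"
proof -
  let ?h = "\<lambda>q. h_B M (hamming_weight M q) p"
  have "mutual_information_bits \<Omega> idx (query M idx S 2)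
      = (\<Sum>m=1..M. \<Sum>q\<in>bit_vecs M. \<P>(\<omega> in \<Omega>. idx \<omega> = m \<and> query M idx S 2 \<omega> = q)
        * log 2 (\<P>(\<omega> in \<Omega>. idx \<omega> = m \<and> query M idx S 2 \<omega> = q)
            / (\<P>(\<omega> in \<Omega>. idx \<omega> = m) * \<P>(\<omega> in \<Omega>. query M idx S 2 \<omega> = q))))"
    by (intro mutual_information_bits_eq_sum prob_space_axioms simple_query simple_idx
        query_image idx_image) auto
  also have "\<dots> = (\<Sum>m=1..M. \<Sum>q\<in>bit_vecs M. ?h q / M * log 2 (?h q / M / (1 / M * ?h q)))"
    by (simp only: prob_query_2 prob_idx prob_idx_query_2 cong: sum.cong)
  also have "\<dots> = 0"
  proof (intro sum.neutral ballI)
    fix q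
    show "?h q / M * log 2 (?h q / M / (1 / M * ?h q)) = 0"
      using M by (cases "?h q = 0") auto
  qed
  finally show ?thesis .
qed

text \<open>The upload cost is the entropy of the first query plus
  \<open>M * binary_entropy p\<close>. Half the first mutual information thus falls short of half
  the upload cost by two halves of that amount.\<close>

theorem leakage_MI_eq:
  "leakage_MI \<Omega> idx (query M idx S) = upload_B M p / 2 - real M * binary_entropy p"
proof -
  have "leakage_MI \<Omega> idx (query M idx S)
      = (mutual_information_bits \<Omega> idx (query M idx S 1)
        + mutual_information_bits \<Omega> idx (query M idx S 2)) / 2"
    by (simp add: leakage_MI_def)
  moreover have "upload_B M p
      = entropy_bits \<Omega> (query M idx S 1) + entropy_bits \<Omega> (query M idx S 2)"
    by (simp add: upload_cost_eq[symmetric] upload_cost_def)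
  ultimately show ?thesis
    by (simp only: mutual_information_query_1 mutual_information_query_2 entropy_query_2) simp
qed

section \<open>Worst-case information leakage\<close>

lemma entropy_idx: "entropy_bits \<Omega> idx = log 2 M"
proof -
  have "entropy_bits \<Omega> idx
      = - (\<Sum>m=1..M. \<P>(\<omega> in \<Omega>. idx \<omega> = m) * log 2 (\<P>(\<omega> in \<Omega>. idx \<omega> = m)))"
    by (intro entropy_bits_eq_sum prob_space_axioms simple_idx idx_image) auto
  also have "\<dots> = - (\<Sum>m=1..M. 1 / M * log 2 (1 / M))"
    by (simp only: prob_idx cong: sum.cong)
  also have "\<dots> = log 2 M" using M by (simp add: log_divide)
  finally show ?thesis .
qed

text \<open>The posterior of the index has one value on the zeros of \<open>q\<close> and another on
  its support. \<open>pmf_B\<close> lists the same values in two consecutive blocks, and entropy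
  ignores the rearrangement.\<close>

lemma entropy_given_query_1:
  assumes q: "q \<in> bit_vecs M" and pos: "0 < \<P>(\<omega> in \<Omega>. query M idx S 1 \<omega> = q)"
  shows "entropy_given_value \<Omega> idx (query M idx S 1) q = entropy_B M (hamming_weight M q) p"
proof -
  let ?w = "hamming_weight M q"
  let ?c = "real M * g_B M ?w p"
  let ?e = "\<lambda>x::real. x * log 2 x"
  have w: "?w \<le> M" by (rule hamming_weight_le)
  have g: "0 < g_B M ?w p" using pos by (simp only: prob_query_1[OF q])
  have "entropy_given_value \<Omega> idx (query M idx S 1) q
      = - (\<Sum>m=1..M. ?e (\<P>(\<omega> in \<Omega>. idx \<omega> = m \<and> query M idx S 1 \<omega> = q)
            / \<P>(\<omega> in \<Omega>. query M idx S 1 \<omega> = q)))"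
    using pos by (intro entropy_given_value_eq_sum prob_space_axioms simple_idx simple_query idx_image) auto
  also have "\<dots> = - (\<Sum>m=1..M. ?e (h_B M (hamming_weight M (flip M m q)) p / M / g_B M ?w p))"
    by (simp only: prob_idx_query_1[OF _ q] prob_query_1[OF q] cong: sum.cong)
  also have "\<dots> = - (\<Sum>m=1..M. if q m = 0 then ?e (h_B M (?w + 1) p / ?c)
      else ?e (h_B M (?w - 1) p / ?c))"
    by (intro arg_cong[where f = uminus] sum.cong refl) (auto simp: hamming_weight_flip)
  also have "\<dots> = - (real (M - ?w) * ?e (h_B M (?w + 1) p / ?c)
      + real ?w * ?e (h_B M (?w - 1) p / ?c))"
    by (simp only: sum_bit_cases)
  \<comment> \<open>As for the averaged masses, the exponents disagree only at weight 0, under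
    prefactor 0.\<close>
  also have "real ?w * ?e (h_B M (?w - 1) p / ?c)
      = real ?w * ?e ((1 - p) ^ (M - ?w + 1) * p ^ (?w - 1) / ?c)"
    using w by (cases "?w = 0") (auto simp: h_B_def Suc_diff_le)
  also have "h_B M (?w + 1) p = (1 - p) ^ (M - ?w - 1) * p ^ (?w + 1)"
    by (simp add: h_B_def)
  also have "- (real (M - ?w) * ?e (\<dots> / ?c)
      + real ?w * ?e ((1 - p) ^ (M - ?w + 1) * p ^ (?w - 1) / ?c)) = entropy_B M ?w p"
    using entropy_B_eq_sum[OF M w p(1) _ g] sum_pmf_B[OF w, of ?e p] p by simp
  finally show ?thesis .
qed

lemma entropy_given_query_2:
  assumes q: "q \<in> bit_vecs M" and pos: "0 < \<P>(\<omega> in \<Omega>. query M idx S 2 \<omega> = q)"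
  shows "entropy_given_value \<Omega> idx (query M idx S 2) q = log 2 M"
proof -
  let ?h = "h_B M (hamming_weight M q) p"
  have h: "0 < ?h" using pos by (simp only: prob_query_2[OF q])
  have "entropy_given_value \<Omega> idx (query M idx S 2) q
      = - (\<Sum>m=1..M. \<P>(\<omega> in \<Omega>. idx \<omega> = m \<and> query M idx S 2 \<omega> = q)
            / \<P>(\<omega> in \<Omega>. query M idx S 2 \<omega> = q)
          * log 2 (\<P>(\<omega> in \<Omega>. idx \<omega> = m \<and> query M idx S 2 \<omega> = q)
            / \<P>(\<omega> in \<Omega>. query M idx S 2 \<omega> = q)))"
    using pos by (intro entropy_given_value_eq_sum prob_space_axioms simple_idx simple_query idx_image) auto
  also have "\<dots> = - (\<Sum>m=1..M. ?h / M / ?h * log 2 (?h / M / ?h))"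
    by (simp only: prob_idx_query_2[OF _ q] prob_query_2[OF q] cong: sum.cong)
  also have "\<dots> = log 2 M" using M h by (simp add: log_divide)
  finally show ?thesis .
qed

text \<open>A value of positive probability must be attained, so the minimum can range over all
  binary vectors of positive mass.\<close>

lemma query_possible:
  "{q \<in> query M idx S l ` space \<Omega>. \<P>(\<omega> in \<Omega>. query M idx S l \<omega> = q) > 0}
    = {q \<in> bit_vecs M. \<P>(\<omega> in \<Omega>. query M idx S l \<omega> = q) > 0}"
proof -
  have "q \<in> query M idx S l ` space \<Omega>" if "\<P>(\<omega> in \<Omega>. query M idx S l \<omega> = q) > 0" for q
  proof (rule ccontr)
    assume "q \<notin> query M idx S l ` space \<Omega>"
    then have "{\<omega> \<in> space \<Omega>. query M idx S l \<omega> = q} = {}" by auto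
    with that show False by (simp only: measure_empty)
  qed
  then show ?thesis using query_in by auto
qed

theorem leakage_WIL_eq:
  "leakage_WIL \<Omega> idx (query M idx S)
    = log 2 (real M) - (MIN w\<in>{w\<in>{0..M}. g_B M w p > 0}. entropy_B M w p)"
proof -
  let ?Q = "\<lambda>l. {q \<in> bit_vecs M. \<P>(\<omega> in \<Omega>. query M idx S l \<omega> = q) > 0}"
  let ?W = "{w\<in>{0..M}. g_B M w p > 0}"
  let ?H = "\<lambda>l q. entropy_given_value \<Omega> idx (query M idx S l) q"
  have Q1: "?Q 1 = {q \<in> bit_vecs M. g_B M (hamming_weight M q) p > 0}"
    using prob_query_1 by (auto simp del: One_nat_def)
  have W: "hamming_weight M ` ?Q 1 = ?W"
  proof
    show "hamming_weight M ` ?Q 1 \<subseteq> ?W" unfolding Q1 using hamming_weight_le by auto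
    show "?W \<subseteq> hamming_weight M ` ?Q 1"
    proof
      fix w assume w: "w \<in> ?W"
      then obtain q where "q \<in> bit_vecs M" "hamming_weight M q = w" using ex_bit_vec[of w] by auto
      then show "w \<in> hamming_weight M ` ?Q 1" unfolding Q1 using w by auto
    qed
  qed
  have "?H 1 ` ?Q 1 = (\<lambda>q. entropy_B M (hamming_weight M q) p) ` ?Q 1"
    using entropy_given_query_1 by (intro image_cong refl) auto
  also have "\<dots> = (\<lambda>w. entropy_B M w p) ` ?W" unfolding W[symmetric] by (simp only: image_image)
  finally have H1: "?H 1 ` ?Q 1 = (\<lambda>w. entropy_B M w p) ` ?W" .
  have H2: "?H 2 ` ?Q 2 = {log 2 M}"
  proof -
    \<comment> \<open>The zero vector has mass \<open>(1 - p) ^ M\<close>, positive because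
      \<open>p < 1\<close>; hence the minimum of the second server is over a nonempty set.\<close>
    obtain q where q: "q \<in> bit_vecs M" "hamming_weight M q = 0" using ex_bit_vec[of 0] by auto
    then have "q \<in> ?Q 2" using p by (simp add: prob_query_2 h_B_def)
    then have "?Q 2 \<noteq> {}" by blast
    then show ?thesis using entropy_given_query_2 by (auto simp: image_iff)
  qed
  have le: "(MIN w\<in>?W. entropy_B M w p) \<le> log 2 M"
  proof -
    \<comment> \<open>Weight 1 is a witness for every admissible \<open>p\<close>: its
      \<open>g_B\<close> contains the term \<open>(1 - p) ^ M / M\<close>. Weight 0 would fail at
      \<open>p = 0\<close>, where its \<open>g_B\<close> vanishes.\<close>
    obtain q where q: "q \<in> bit_vecs M" "hamming_weight M q = 1" using ex_bit_vec[of 1] M by auto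
    have "0 < (1 - p) ^ M / M" using p M by simp
    also have "\<dots> \<le> g_B M (hamming_weight M q) p" using p M q(2)
      by (simp add: g_B_def divide_simps flip: power_Suc)
    finally have pos: "q \<in> ?Q 1" unfolding Q1 using q by simp
    then have "?H 1 q \<le> log 2 (card {1..M})"
      by (intro entropy_given_value_le_log_card prob_space_axioms simple_idx simple_query idx_image) auto
    moreover have "Min (?H 1 ` ?Q 1) \<le> ?H 1 q" using pos by (intro Min_le) auto
    ultimately show ?thesis unfolding H1 by simp
  qed
  show ?thesis
    unfolding leakage_WIL_def query_possible Max_servers H1 H2 entropy_idx
    using le by simp
qed

section \<open>Maximal leakage\<close>

text \<open>Uniformity of the index turns each conditional probability into \<open>M\<close> times a
  joint mass, and a vector that is never sent has maximum 0.\<close>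

lemma sum_query_image:
  assumes "l \<in> {1, 2}"
  shows "(\<Sum>q\<in>query M idx S l ` space \<Omega>. MAX m\<in>{1..M}. \<P>(\<omega> in \<Omega>. query M idx S l \<omega> = q \<bar> idx \<omega> = m))
    = (\<Sum>q\<in>bit_vecs M. MAX m\<in>{1..M}. M * \<P>(\<omega> in \<Omega>. idx \<omega> = m \<and> query M idx S l \<omega> = q))"
proof -
  let ?f = "\<lambda>q m. M * \<P>(\<omega> in \<Omega>. idx \<omega> = m \<and> query M idx S l \<omega> = q)"
  have "\<P>(\<omega> in \<Omega>. query M idx S l \<omega> = q \<bar> idx \<omega> = m) = ?f q m" if "m \<in> {1..M}" for m q
    unfolding cond_prob_def prob_idx[OF that] by (simp add: conj_commute)
  then have "(\<Sum>q\<in>query M idx S l ` space \<Omega>.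
        MAX m\<in>{1..M}. \<P>(\<omega> in \<Omega>. query M idx S l \<omega> = q \<bar> idx \<omega> = m))
      = (\<Sum>q\<in>query M idx S l ` space \<Omega>. Max (?f q ` {1..M}))"
    by (intro sum.cong arg_cong[where f = Max] image_cong refl)
  also have "\<dots> = (\<Sum>q\<in>bit_vecs M. Max (?f q ` {1..M}))"
  proof (rule sum.mono_neutral_left[OF finite_bit_vecs query_image], safe)
    fix q assume "q \<notin> query M idx S l ` space \<Omega>"
    then have "{\<omega> \<in> space \<Omega>. idx \<omega> = m \<and> query M idx S l \<omega> = q} = {}" for m by auto
    then have "?f q m = 0" for m by (simp only: measure_empty mult_zero_right)
    then have "?f q ` {1..M} = {0}" using M by auto
    then show "Max (?f q ` {1..M}) = 0" by (simp only: Max_singleton)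
  qed
  finally show ?thesis .
qed

lemma Max_flip_h:
  assumes "q \<in> bit_vecs M"
  shows "(MAX m\<in>{1..M}. h_B M (hamming_weight M (flip M m q)) p)
    = (if hamming_weight M q = 0 then h_B M 1 p else h_B M (hamming_weight M q - 1) p)"
proof (cases "hamming_weight M q = 0")
  case True
  then have "q m = 0" if "m \<in> {1..M}" for m
    using that by (auto simp: hamming_weight_def)
  then have "(\<lambda>m. h_B M (hamming_weight M (flip M m q)) p) ` {1..M} = (\<lambda>m. h_B M 1 p) ` {1..M}"
    by (intro image_cong refl) (simp add: hamming_weight_flip True)
  also have "\<dots> = {h_B M 1 p}" using M by auto
  finally show ?thesis by (simp add: True)
next
  case False
  let ?w = "hamming_weight M q"
  from False obtain m where m: "m \<in> {1..M}" "q m \<noteq> 0"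
    unfolding hamming_weight_def by (metis (mono_tags, lifting) Collect_empty_eq card.empty)
  have "(MAX m\<in>{1..M}. h_B M (hamming_weight M (flip M m q)) p) = h_B M (?w - 1) p"
  proof (rule Max_eqI)
    show "h_B M (?w - 1) p \<in> (\<lambda>m. h_B M (hamming_weight M (flip M m q)) p) ` {1..M}"
      using m by (intro image_eqI[of _ _ m]) (simp_all add: hamming_weight_flip)
    fix y assume "y \<in> (\<lambda>m. h_B M (hamming_weight M (flip M m q)) p) ` {1..M}"
    then obtain k where k: "k \<in> {1..M}" and y: "y = h_B M (hamming_weight M (flip M k q)) p" by auto
    show "y \<le> h_B M (?w - 1) p"
    proof (cases "q k = 0")
      \<comment> \<open>The position \<open>k\<close> is a zero of \<open>q\<close>, so the weight
        is below \<open>M\<close> and the natural subtractions in the exponents are exact. The two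
        masses then share a common factor and differ by \<open>p ^ 2\<close> against
        \<open>(1 - p) ^ 2\<close>, which \<open>p \<le> 1 / 2\<close> compares.\<close>
      case True
      then have "?w + 1 \<le> M"
        using hamming_weight_le[of M "flip M k q"] k by (simp add: hamming_weight_flip)
      then have a: "M - (?w - 1) = (M - (?w + 1)) + 2" using False by simp
      have b: "?w + 1 = (?w - 1) + 2" using False by simp
      have "h_B M (?w + 1) p = (1 - p) ^ (M - (?w + 1)) * p ^ (?w - 1) * p ^ 2"
        unfolding h_B_def by (subst (2) b) (simp only: power_add mult.assoc)
      also have "\<dots> \<le> (1 - p) ^ (M - (?w + 1)) * p ^ (?w - 1) * (1 - p) ^ 2"
        using p by (intro mult_left_mono power_mono) auto
      also have "\<dots> = h_B M (?w - 1) p"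
        unfolding h_B_def a by (simp only: power_add mult_ac)
      finally show ?thesis using y k True by (simp add: hamming_weight_flip)
    next
      case False
      then show ?thesis using y k by (simp add: hamming_weight_flip)
    qed
  qed simp
  then show ?thesis using False by simp
qed

theorem leakage_MaxL_eq:
  "leakage_MaxL \<Omega> M idx (query M idx S)
    = log 2 ((1 - p) ^ (M - 1) * p
        + (\<Sum>w=1..M. real (M choose w) * (1 - p) ^ (M - (w - 1)) * p ^ (w - 1)))"
proof -
  let ?h = "\<lambda>m q. h_B M (hamming_weight M (flip M m q)) p"
  let ?T = "\<Sum>q\<in>bit_vecs M. MAX m\<in>{1..M}. ?h m q"
  have 1: "(\<Sum>q\<in>query M idx S 1 ` space \<Omega>.
      MAX m\<in>{1..M}. \<P>(\<omega> in \<Omega>. query M idx S 1 \<omega> = q \<bar> idx \<omega> = m)) = ?T"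
    using M by (subst sum_query_image, simp)
      (intro sum.cong arg_cong[where f = Max] image_cong refl, subst prob_idx_query_1, auto)
  have "(\<Sum>q\<in>query M idx S 2 ` space \<Omega>.
        MAX m\<in>{1..M}. \<P>(\<omega> in \<Omega>. query M idx S 2 \<omega> = q \<bar> idx \<omega> = m))
      = (\<Sum>q\<in>bit_vecs M. MAX m\<in>{1..M}. h_B M (hamming_weight M q) p)"
    using M by (subst sum_query_image, simp)
      (intro sum.cong arg_cong[where f = Max] image_cong refl, subst prob_idx_query_2, auto)
  also have "\<dots> = (\<Sum>q\<in>bit_vecs M. h_B M (hamming_weight M q) p)"
  proof (intro sum.cong refl)
    fix q
    have "(\<lambda>m. h_B M (hamming_weight M q) p) ` {1..M} = {h_B M (hamming_weight M q) p}"
      using M by auto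
    then show "(MAX m\<in>{1..M}. h_B M (hamming_weight M q) p) = h_B M (hamming_weight M q) p"
      by (simp only: Max_singleton)
  qed
  also have "\<dots> = 1" by (rule sum_h)
  finally have 2: "(\<Sum>q\<in>query M idx S 2 ` space \<Omega>.
      MAX m\<in>{1..M}. \<P>(\<omega> in \<Omega>. query M idx S 2 \<omega> = q \<bar> idx \<omega> = m)) = 1" .
  \<comment> \<open>The conditional law given index 1 has total 1 and lies below the pointwise
    maxima. This makes the logarithm for the first server nonnegative, so it wins against
    \<open>log 2 1\<close>.\<close>
  have "1 = (\<Sum>q\<in>bit_vecs M. ?h 1 q)"
    unfolding sum_h[of M p, symmetric]
    by (rule sum.reindex_bij_betw[OF bij_betw_flip, symmetric,
          where g = "\<lambda>q. h_B M (hamming_weight M q) p"])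
  also have "\<dots> \<le> ?T" using M by (intro sum_mono Max_ge) auto
  finally have ge: "1 \<le> ?T" .
  let ?f = "\<lambda>w. if w = 0 then h_B M 1 p else h_B M (w - 1) p"
  have "?T = (\<Sum>q\<in>bit_vecs M. ?f (hamming_weight M q))"
    by (intro sum.cong refl Max_flip_h)
  also have "\<dots> = (\<Sum>w=0..M. real (M choose w) * ?f w)" by (rule sum_bit_vecs_weight)
  \<comment> \<open>The zero vector is split off because each of its flips has weight 1, the only
    case in which no flip lowers the weight; it yields the isolated summand.\<close>
  also have "\<dots> = ?f 0 + (\<Sum>w=1..M. real (M choose w) * ?f w)"
    by (simp add: sum.atLeast_Suc_atMost)
  also have "(\<Sum>w=1..M. real (M choose w) * ?f w)
      = (\<Sum>w=1..M. real (M choose w) * (1 - p) ^ (M - (w - 1)) * p ^ (w - 1))"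
    by (intro sum.cong refl) (simp add: h_B_def)
  also have "?f 0 = (1 - p) ^ (M - 1) * p" by (simp add: h_B_def)
  finally have T: "?T = (1 - p) ^ (M - 1) * p
      + (\<Sum>w=1..M. real (M choose w) * (1 - p) ^ (M - (w - 1)) * p ^ (w - 1))" .
  have "leakage_MaxL \<Omega> M idx (query M idx S) = log 2 ?T"
    unfolding leakage_MaxL_def Max_servers 1 2 using ge by simp
  then show ?thesis unfolding T .
qed

end

theorem theorem5:
  fixes \<Omega> :: "'a measure"
    and M :: nat
    and p :: real
    and idx :: "'a \<Rightarrow> nat"
    and S X :: "nat \<Rightarrow> 'a \<Rightarrow> bit"
  assumes "1 \<le> M"
    and "0 \<le> p" and "p \<le> 1 / 2"
    and "scheme_B \<Omega> M idx S X"
    and "iid_bernoulli \<Omega> M S p"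
  shows "rate \<Omega> file_length (answer_length M idx S X) = 1 / 2
    \<and> upload_cost \<Omega> (query M idx S) = upload_B M p
    \<and> access_complexity \<Omega> (query M idx S) (hamming_weight M)
        = (\<Sum>w=0..M. real w * real (M choose w) * (g_B M w p + h_B M w p))
    \<and> leakage_MI \<Omega> idx (query M idx S) = upload_B M p / 2 - real M * binary_entropy p
    \<and> leakage_WIL \<Omega> idx (query M idx S)
        = log 2 (real M) - (MIN w\<in>{w\<in>{0..M}. g_B M w p > 0}. entropy_B M w p)
    \<and> leakage_MaxL \<Omega> M idx (query M idx S)
        = log 2 ((1 - p) ^ (M - 1) * p
            + (\<Sum>w=1..M. real (M choose w) * (1 - p) ^ (M - (w - 1)) * p ^ (w - 1)))"
proof -
  interpret prob_space \<Omega>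
    using assms(4) by (simp add: scheme_B_def)
  interpret bernoulli_scheme_B \<Omega> M p idx S X
    using assms by unfold_locales
  show ?thesis
    by (intro conjI rate_eq upload_cost_eq access_complexity_eq leakage_MI_eq leakage_WIL_eq
        leakage_MaxL_eq)
qed

end
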